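(* Let $n>1$ and let $\phi\colon X\to\mathfrak{u}(n)\oplus\mathfrak{gl}(n,\mathbb{C})$, where $X=\operatorname{Hom}_{\mathbb{C}}(\mathbb{C}^n,\mathbb{C}^n)\oplus\operatorname{Hom}_{\mathbb{C}}(\mathbb{C}^n,\mathbb{C}^n)$, be the map $$\phi(A,B)=\left(\tfrac{i}{2}(A^*A-BB^* ),\,BA\right).$$ Let $U(n)_{\mathrm{L}}$ denote the unitary group $U(n)$ acting on $X$ by $U\cdot(A,B)=(UA,BU^{-1})$; this action leaves $\phi$ invariant. Then the quotient $\phi^{-1}(0,0)/U(n)_{\mathrm{L}}$ may be identified with the set of non-negative Hermitian $n\times n$ matrices of rank at most $n/2$.
   Context: $A^*$ denotes the conjugate transpose. A Hermitian matrix is non-negative if all its eigenvalues are $\geqslant 0$. The map $\phi$ is the hyperkähler moment map for the action $V\cdot(A,B)=(AV^{-1},VB)$ of $U(n)$ on the flat hyperkähler vector space $X=\mathbb{H}^{n^2}$. *)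

theory Defs
  imports "HOL-Analysis.Analysis"
begin

definition conj_transpose :: "complex^'n^'m \<Rightarrow> complex^'m^'n" where
  "conj_transpose A = (\<chi> i j. cnj (A $ j $ i))"

definition unitary_group :: "(complex^'n^'n) set" where
  "unitary_group = {U. conj_transpose U ** U = mat 1 \<and> U ** conj_transpose U = mat 1}"

text \<open>The Lie algebra of the unitary group.\<close>

definition skew_hermitian :: "(complex^'n^'n) set" where
  "skew_hermitian = {S. conj_transpose S = - S}"

definition hermitian :: "complex^'n^'n \<Rightarrow> bool" where
  "hermitian H \<longleftrightarrow> conj_transpose H = H"

definition eigenvalue :: "complex^'n^'n \<Rightarrow> complex \<Rightarrow> bool" where
  "eigenvalue H c \<longleftrightarrow> (\<exists>v. v \<noteq> 0 \<and> H *v v = c *s v)"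

definition nonneg_hermitian :: "complex^'n^'n \<Rightarrow> bool" where
  "nonneg_hermitian H \<longleftrightarrow> hermitian H \<and> (\<forall>c. eigenvalue H c \<longrightarrow> c \<in> \<real>\<^sub>\<ge>\<^sub>0)"

text \<open>
  Endomorphisms of \<open>\<complex>\<^sup>n\<close> are identified with their matrices, so that the space \<open>X\<close> is the type
  of pairs of matrices. The factor \<open>mat (\<i> / 2)\<close> is multiplication by the scalar \<open>\<i> / 2\<close>.
\<close>

definition moment_map ::
    "(complex^'n^'n) \<times> (complex^'n^'n) \<Rightarrow> (complex^'n^'n) \<times> (complex^'n^'n)" where
  "moment_map = (\<lambda>(A, B).
     (mat (\<i> / 2) ** (conj_transpose A ** A - B ** conj_transpose B), B ** A))"

definition left_action ::
    "complex^'n^'n \<Rightarrow> (complex^'n^'n) \<times> (complex^'n^'n) \<Rightarrow> (complex^'n^'n) \<times> (complex^'n^'n)" where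
  "left_action U = (\<lambda>(A, B). (U ** A, B ** matrix_inv U))"

definition orbit_rel ::
    "(((complex^'n^'n) \<times> (complex^'n^'n)) \<times> ((complex^'n^'n) \<times> (complex^'n^'n))) set" where
  "orbit_rel = {(p, q). \<exists>U\<in>unitary_group. q = left_action U p}"

definition zero_fibre :: "((complex^'n^'n) \<times> (complex^'n^'n)) set" where
  "zero_fibre = moment_map -` {(0, 0)}"

definition quotient_topology :: "'a topology \<Rightarrow> ('a \<times> 'a) set \<Rightarrow> 'a set topology" where
  "quotient_topology X r = topology (\<lambda>V. V \<subseteq> topspace X // r \<and>
     openin X {x \<in> topspace X. r `` {x} \<in> V})"

lemma openin_quotient_topology:
  "openin (quotient_topology X r) V \<longleftrightarrow>
     V \<subseteq> topspace X // r \<and> openin X {x \<in> topspace X. r `` {x} \<in> V}"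
proof -
  have "istopology (\<lambda>V. V \<subseteq> topspace X // r \<and> openin X {x \<in> topspace X. r `` {x} \<in> V})"
    unfolding istopology_def
  proof (intro conjI allI impI)
    fix S T
    assume S: "S \<subseteq> topspace X // r \<and> openin X {x \<in> topspace X. r `` {x} \<in> S}"
      and T: "T \<subseteq> topspace X // r \<and> openin X {x \<in> topspace X. r `` {x} \<in> T}"
    show "S \<inter> T \<subseteq> topspace X // r" using S by blast
    have "{x \<in> topspace X. r `` {x} \<in> S \<inter> T} =
        {x \<in> topspace X. r `` {x} \<in> S} \<inter> {x \<in> topspace X. r `` {x} \<in> T}" by blast
    then show "openin X {x \<in> topspace X. r `` {x} \<in> S \<inter> T}"
      using S T by (simp add: openin_Int)
  next
    fix K
    assume K: "\<forall>S\<in>K. S \<subseteq> topspace X // r \<and> openin X {x \<in> topspace X. r `` {x} \<in> S}"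
    show "\<Union>K \<subseteq> topspace X // r" using K by blast
    have "{x \<in> topspace X. r `` {x} \<in> \<Union>K} =
        (\<Union>S\<in>K. {x \<in> topspace X. r `` {x} \<in> S})" by blast
    then show "openin X {x \<in> topspace X. r `` {x} \<in> \<Union>K}"
      using K by (metis (no_types, lifting) imageE openin_Union)
  qed
  then show ?thesis by (simp add: quotient_topology_def)
qed

lemma topspace_quotient_topology: "topspace (quotient_topology X r) = topspace X // r"
proof -
  have "{x \<in> topspace X. r `` {x} \<in> topspace X // r} = topspace X"
    by (auto simp: quotient_def)
  then have "openin (quotient_topology X r) (topspace X // r)"
    by (simp add: openin_quotient_topology)
  then show ?thesis
    by (meson openin_quotient_topology openin_subset openin_topspace subset_antisym)
qed

lemma quotient_map_quotient_topology:
  "quotient_map X (quotient_topology X r) (\<lambda>x. r `` {x})"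
  unfolding quotient_map_def topspace_quotient_topology
  by (auto simp: openin_quotient_topology quotient_def)

lemma conj_transpose_mult: "conj_transpose (A ** B) = conj_transpose B ** conj_transpose A"
  by (simp add: conj_transpose_def matrix_matrix_mult_def vec_eq_iff mult.commute)

lemma conj_transpose_conj_transpose [simp]: "conj_transpose (conj_transpose A) = A"
  by (simp add: conj_transpose_def vec_eq_iff)

lemma matrix_inv_unitary:
  assumes "U \<in> unitary_group"
  shows "matrix_inv U = conj_transpose U"
proof -
  have U: "conj_transpose U ** U = mat 1" "U ** conj_transpose U = mat 1"
    using assms by (auto simp: unitary_group_def)
  have "U ** matrix_inv U = mat 1 \<and> matrix_inv U ** U = mat 1"
    unfolding matrix_inv_def by (rule someI[where x = "conj_transpose U"]) (use U in auto)
  then show ?thesis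
    by (metis U(1) matrix_mul_assoc matrix_mul_lid matrix_mul_rid)
qed

lemma unitary_group_mult:
  assumes "U \<in> unitary_group" "V \<in> unitary_group"
  shows "U ** V \<in> unitary_group"
  using assms unfolding unitary_group_def mem_Collect_eq conj_transpose_mult
  by (metis matrix_mul_assoc matrix_mul_lid)

lemma unitary_group_one: "mat 1 \<in> unitary_group"
proof -
  have "conj_transpose (mat 1) = mat 1"
    by (simp add: conj_transpose_def mat_def vec_eq_iff)
  then show ?thesis by (simp add: unitary_group_def)
qed

lemma unitary_group_inv:
  assumes "U \<in> unitary_group"
  shows "matrix_inv U \<in> unitary_group"
  using assms by (simp add: matrix_inv_unitary) (simp add: unitary_group_def)

lemma left_action_one: "left_action (mat 1 :: complex^'n^'n) p = p"
proof -
  have "matrix_inv (mat 1 :: complex^'n^'n) = mat 1"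
    unfolding matrix_inv_unitary[OF unitary_group_one]
    by (simp add: conj_transpose_def mat_def vec_eq_iff)
  then show ?thesis by (simp add: left_action_def split: prod.split)
qed

lemma left_action_mult:
  assumes "U \<in> unitary_group" "V \<in> unitary_group"
  shows "left_action (U ** V) p = left_action U (left_action V p)"
  using assms unitary_group_mult[OF assms]
  by (auto simp: left_action_def matrix_inv_unitary conj_transpose_mult matrix_mul_assoc
      split: prod.split)

lemma equiv_orbit_rel: "equiv UNIV orbit_rel"
proof (rule equivI)
  show "orbit_rel \<subseteq> UNIV \<times> UNIV" by simp
  show "refl_on UNIV orbit_rel"
    unfolding refl_on_def orbit_rel_def
    by (auto intro!: bexI[OF _ unitary_group_one] simp: left_action_one)
  show "sym orbit_rel"
  proof (rule symI)
    fix p q :: "(complex^'n^'n) \<times> (complex^'n^'n)"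
    assume "(p, q) \<in> orbit_rel"
    then obtain U where U: "U \<in> unitary_group" "q = left_action U p"
      by (auto simp: orbit_rel_def)
    have "matrix_inv U ** U = mat 1"
      using U(1) by (simp add: matrix_inv_unitary) (simp add: unitary_group_def)
    then have "p = left_action (matrix_inv U) q"
      using U left_action_mult[OF unitary_group_inv[OF U(1)] U(1), of p]
      by (simp add: left_action_one)
    then show "(q, p) \<in> orbit_rel"
      using unitary_group_inv[OF U(1)] by (auto simp: orbit_rel_def)
  qed
  show "trans orbit_rel"
    unfolding trans_def orbit_rel_def
    using unitary_group_mult left_action_mult by (smt (verit) case_prodD case_prodI mem_Collect_eq)
qed

end

theory Submission
  imports Defs
begin

text \<open>
  The map \<open>(A, B) \<mapsto> A\<^sup>*A\<close> induces the homeomorphism. On the zero fibre write \<open>A\<^sup>*A = BB\<^sup>* = UDU\<^sup>*\<close>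
  with \<open>U\<close> unitary and \<open>D\<close> diagonal. Then \<open>M = AU\<close> and \<open>N = B\<^sup>*U\<close> satisfy
  \<open>M\<^sup>*M = N\<^sup>*N = D\<close> and, since \<open>BA = 0\<close>, also \<open>N\<^sup>*M = 0\<close>. Hence the normalized nonzero columns of
  \<open>M\<close> and \<open>N\<close> together form an orthonormal family of \<open>2 rank D\<close> vectors, which bounds the rank, and
  completing this family to a unitary matrix \<open>W\<close> shows that \<open>W\<^sup>*\<close> carries \<open>(A, B)\<close> to a pair that
  depends only on \<open>U\<close> and \<open>D\<close>; that pair exists whenever \<open>2 rank D \<le> n\<close>. Finally,
  \<open>|A|\<^sup>2 = |B|\<^sup>2 = tr (A\<^sup>*A)\<close> on the zero fibre, so the map is proper, thus closed, thus a quotient map.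
\<close>

section \<open>Unitary diagonalization\<close>

text \<open>Rayleigh's principle: a maximizer of \<open>inner x (f x)\<close> on the compact unit
  sphere of \<open>W\<close> is an eigenvector, with the maximum as eigenvalue. Keeping
  \<open>v\<close> in a prescribed invariant subspace lets eigenvectors be split off one at a
  time.\<close>

lemma selfadjoint_invariant_subspace_eigenvector:
  fixes f :: "'a::euclidean_space \<Rightarrow> 'a"
  assumes lin: "linear f" and sym: "\<And>x y. inner (f x) y = inner x (f y)"
    and W: "subspace W" "\<And>x. x \<in> W \<Longrightarrow> f x \<in> W" "w \<in> W" "w \<noteq> 0"
  obtains v c where "v \<in> W" "norm v = 1" "f v = c *\<^sub>R v"
proof -
  let ?S = "sphere 0 1 \<inter> W"
  have comp: "compact ?S"
    using W(1) by (intro compact_Int_closed closed_subspace) auto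
  have "(1 / norm w) *\<^sub>R w \<in> ?S"
    using W by (auto intro: subspace_scale)
  then have ne: "?S \<noteq> {}" by blast
  have "continuous_on ?S (\<lambda>x. inner x (f x))"
    using lin by (intro continuous_intros linear_continuous_on linear_conv_bounded_linear[THEN iffD1])
  from continuous_attains_sup[OF comp ne this]
  obtain v where v: "v \<in> ?S" "\<And>y. y \<in> ?S \<Longrightarrow> inner y (f y) \<le> inner v (f v)" by blast
  define c where "c = inner v (f v)"
  have nv: "inner v v = 1" using v(1) by (simp add: norm_eq_1)
  \<comment> \<open>Homogeneity of degree two carries the maximality from the unit sphere to all of
    \<open>W\<close>.\<close>
  have bound: "inner x (f x) \<le> c * inner x x" if "x \<in> W" for x
  proof (cases "x = 0")
    case True
    then show ?thesis using lin by (simp add: linear_0)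
  next
    case False
    let ?y = "(1 / norm x) *\<^sub>R x"
    have "?y \<in> ?S" using that W(1) False by (auto intro: subspace_scale)
    from v(2)[OF this] have "inner x (f x) / (norm x * norm x) \<le> c"
      using lin by (simp add: c_def linear_scale)
    then show ?thesis using False
      by (simp add: dot_square_norm power2_eq_square divide_le_eq)
  qed
  let ?y = "c *\<^sub>R v - f v"
  have yW: "?y \<in> W" using v(1) W by (auto intro!: subspace_diff subspace_scale)
  \<comment> \<open>The form \<open>c \<langle>x, x\<rangle> - \<langle>x, f x\<rangle>\<close> is nonnegative on \<open>W\<close> and vanishes at \<open>v\<close>, so its first
    variation at \<open>v\<close> vanishes.\<close>
  define q where "q = c * inner ?y ?y - inner ?y (f ?y)"
  have "0 \<le> 2 * t * inner ?y ?y + t\<^sup>2 * q" for t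
  proof -
    have "v + t *\<^sub>R ?y \<in> W" using v(1) yW W(1) by (auto intro: subspace_add subspace_scale)
    from bound[OF this]
    have "0 \<le> c * inner (v + t *\<^sub>R ?y) (v + t *\<^sub>R ?y) - inner (v + t *\<^sub>R ?y) (f v + t *\<^sub>R f ?y)"
      using lin by (simp add: linear_add linear_scale)
    also have "\<dots> = c * inner v v - inner v (f v) + 2 * t * (c * inner v ?y - inner (f v) ?y) + t\<^sup>2 * q"
      using sym[of v ?y] unfolding q_def
      by (simp only: inner_add_left inner_add_right inner_scaleR_left inner_scaleR_right
          inner_commute[of ?y "f v"] inner_commute[of ?y v])
        (simp add: algebra_simps power2_eq_square)
    also have "c * inner v ?y - inner (f v) ?y = inner ?y ?y"
      by (simp only: inner_diff_left inner_scaleR_left)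
    finally show ?thesis by (simp add: nv c_def)
  qed note quad = this
  have "inner ?y ?y = 0"
  proof (rule ccontr)
    let ?e = "inner ?y ?y"
    assume "?e \<noteq> 0"
    then have e: "?e > 0" by simp
    \<comment> \<open>For small negative \<open>t\<close> the linear term dominates. The choice
      \<open>t = - ?e / m\<close>, with \<open>m > 0\<close> and \<open>m \<ge> q\<close>, brings
      the quadratic down to at most \<open>- (?e * ?e / m)\<close>, which is negative.\<close>
    define m where "m = \<bar>q\<bar> + 1"
    have m: "m > 0" "q \<le> m" by (auto simp: m_def)
    have "0 \<le> 2 * (- ?e / m) * ?e + (- ?e / m)\<^sup>2 * q" by (rule quad)
    also have "\<dots> \<le> 2 * (- ?e / m) * ?e + (- ?e / m)\<^sup>2 * m"
      using m by (intro add_left_mono mult_left_mono) auto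
    also have "\<dots> = - (?e * ?e / m)" using m(1) by (simp add: field_simps power2_eq_square)
    finally show False using e m(1)
      by (metis divide_pos_pos mult_pos_pos neg_0_le_iff_le not_less)
  qed
  then have "f v = c *\<^sub>R v" by simp
  then show ?thesis using that v(1) by auto
qed

section \<open>The Hermitian inner product on C^n and orthonormal families\<close>

lemma scaleR_vec_complex: "r *\<^sub>R x = complex_of_real r *s (x :: complex^'n)"
  unfolding vec_eq_iff vector_scaleR_component vector_smult_component
  by (simp add: scaleR_conv_of_real)

text \<open>Conjugate-linear in the first argument, so that the entries of
  \<open>conj_transpose A ** B\<close> are its values on columns. Its real part is the Euclidean
  \<open>inner\<close>, which links it to the real variational argument.\<close>

definition cinner :: "complex^'n \<Rightarrow> complex^'n \<Rightarrow> complex" where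
  "cinner x y = (\<Sum>i\<in>UNIV. cnj (x $ i) * y $ i)"

lemma Re_cinner: "Re (cinner x y) = inner x y"
  by (simp add: cinner_def inner_vec_def inner_complex_def)

lemma cinner_self: "cinner x x = complex_of_real ((norm x)\<^sup>2)"
proof -
  have "Im (cinner x x) = 0" by (simp add: cinner_def)
  moreover have "Re (cinner x x) = (norm x)\<^sup>2" by (simp add: Re_cinner power2_norm_eq_inner)
  ultimately show ?thesis by (simp add: complex_eq_iff)
qed

lemma cinner_commute: "cinner x y = cnj (cinner y x)"
  by (simp add: cinner_def mult.commute)

lemma cinner_scale_right: "cinner x (c *s y) = c * cinner x y"
  by (simp add: cinner_def sum_distrib_left mult.left_commute)

lemma cinner_scale_left: "cinner (c *s x) y = cnj c * cinner x y"
  by (simp add: cinner_def sum_distrib_left mult.assoc)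

lemma cinner_zero_right [simp]: "cinner x 0 = 0"
  by (simp add: cinner_def)

lemma cinner_add_right: "cinner x (y + z) = cinner x y + cinner x z"
  by (simp add: cinner_def sum.distrib algebra_simps)

lemma cinner_sum_right: "cinner x (\<Sum>i\<in>I. g i) = (\<Sum>i\<in>I. cinner x (g i))"
  by (simp add: cinner_def sum_distrib_left) (rule sum.swap)

lemma cinner_matrix_vector: "cinner x (A *v y) = cinner (conj_transpose A *v x) y"
  unfolding cinner_def conj_transpose_def matrix_vector_mult_def
  by (simp add: sum_distrib_left sum_distrib_right) (subst sum.swap, simp add: ac_simps)

lemma conj_transpose_mult_nth:
  "(conj_transpose A ** B) $ i $ j = cinner (column i A) (column j B)"
  by (simp add: conj_transpose_def matrix_matrix_mult_def cinner_def column_def)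

lemma column_matrix_mult: "column j (A ** B) = A *v column j B"
  by (simp add: column_def matrix_matrix_mult_def matrix_vector_mult_def vec_eq_iff)

text \<open>Families are indexed because indices record column positions; the index type is free so
  that two families can be merged over a disjoint sum.\<close>

definition orthonormal_on :: "'k set \<Rightarrow> ('k \<Rightarrow> complex^'n) \<Rightarrow> bool" where
  "orthonormal_on I f \<longleftrightarrow> (\<forall>i\<in>I. \<forall>j\<in>I. cinner (f i) (f j) = (if i = j then 1 else 0))"

lemma orthonormal_on_imp_inj_on:
  assumes "orthonormal_on I f"
  shows "inj_on f I"
  using assms unfolding orthonormal_on_def inj_on_def by (metis zero_neq_one)

lemma orthonormal_on_imp_independent:
  assumes on: "orthonormal_on I f" and fin: "finite I"
  shows "vec.independent (f ` I)"
proof (rule vec.independent_if_scalars_zero)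
  show "finite (f ` I)" using fin by simp
next
  fix c x
  assume s: "(\<Sum>x\<in>f ` I. c x *s x) = 0" and "x \<in> f ` I"
  then obtain i where i: "i \<in> I" "x = f i" by blast
  have "0 = cinner (f i) (\<Sum>j\<in>I. c (f j) *s f j)"
    using s by (simp add: sum.reindex[OF orthonormal_on_imp_inj_on[OF on]])
  also have "\<dots> = (\<Sum>j\<in>I. if i = j then c (f j) else 0)"
    unfolding cinner_sum_right cinner_scale_right
    using on i(1) by (intro sum.cong) (auto simp: orthonormal_on_def)
  also have "\<dots> = c x" using fin i by simp
  finally show "c x = 0" by simp
qed

lemma orthonormal_on_card_le:
  fixes f :: "'k \<Rightarrow> complex^'n"
  assumes on: "orthonormal_on I f" and fin: "finite I"
  shows "card I \<le> CARD('n)"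
proof -
  have "card I = vec.dim (f ` I)"
    using vec.dim_eq_card_independent[OF orthonormal_on_imp_independent[OF on fin]]
    by (simp add: card_image orthonormal_on_imp_inj_on[OF on])
  also have "\<dots> \<le> CARD('n)" by (rule dim_subset_UNIV_cart_gen)
  finally show ?thesis .
qed

text \<open>The vacant index \<open>a\<close> replaces the dimension count: the square matrix with
  rows \<open>cnj (f i)\<close> for \<open>i \<in> I\<close> and zero rows elsewhere is not
  surjective, since row \<open>a\<close> vanishes, hence it has a nonzero kernel vector.\<close>

lemma exists_nonzero_cinner_orthogonal:
  fixes f :: "'n \<Rightarrow> complex^'n"
  assumes "a \<notin> I"
  obtains x where "x \<noteq> 0" "\<And>i. i \<in> I \<Longrightarrow> cinner (f i) x = 0"
proof -
  define M :: "complex^'n^'n" where "M = (\<chi> i j. if i \<in> I then cnj (f i $ j) else 0)"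
  have M: "(M *v x) $ i = (if i \<in> I then cinner (f i) x else 0)" for x i
    by (simp add: M_def matrix_vector_mult_def cinner_def)
  have "\<not> surj ((*v) M)"
  proof
    assume "surj ((*v) M)"
    then obtain x where "M *v x = axis a 1" by (metis surj_def)
    then show False using M[of x a] assms by simp
  qed
  then have "\<not> inj ((*v) M)"
    using matrix_left_invertible_injective[of M] matrix_right_invertible_surjective[of M]
      matrix_left_right_inverse by metis
  then obtain x where "x \<noteq> 0" "M *v x = 0" by (metis vec.inj_iff_eq_0 matrix_vector_mul_linear_gen)
  then show ?thesis using that M by (metis zero_index)
qed

lemma orthonormal_on_insert:
  assumes "orthonormal_on I f" "a \<notin> I" "norm v = 1" "\<And>i. i \<in> I \<Longrightarrow> cinner (f i) v = 0"
  shows "orthonormal_on (insert a I) (f(a := v))"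
proof -
  have "cinner v v = 1" using assms(3) by (simp add: cinner_self)
  moreover have "cinner v (f i) = 0" if "i \<in> I" for i
    using assms(4)[OF that] cinner_commute[of v "f i"] by simp
  ultimately show ?thesis using assms by (auto simp: orthonormal_on_def)
qed

text \<open>Vacant indices are filled one at a time by a unit vector orthogonal to all earlier ones,
  which exists as long as an index is vacant.\<close>

lemma orthonormal_on_extend:
  fixes f :: "'n::finite \<Rightarrow> complex^'n"
  assumes f: "orthonormal_on I f"
  obtains g where "orthonormal_on UNIV g" "\<And>i. i \<in> I \<Longrightarrow> g i = f i"
proof -
  have "\<exists>g. orthonormal_on (I \<union> J) g \<and> (\<forall>i\<in>I. g i = f i)" if "finite J" for J
    using that
  proof induction
    case empty
    then show ?case using f by auto
  next
    case (insert a J)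
    then obtain g where g: "orthonormal_on (I \<union> J) g" "\<forall>i\<in>I. g i = f i" by blast
    show ?case
    proof (cases "a \<in> I")
      case True
      then show ?thesis using g by (metis Un_insert_right insert_absorb UnI1)
    next
      case False
      with insert have "a \<notin> I \<union> J" by simp
      from exists_nonzero_cinner_orthogonal[OF this, of g]
      obtain x where x: "x \<noteq> 0" "\<And>i. i \<in> I \<union> J \<Longrightarrow> cinner (g i) x = 0" by metis
      let ?v = "complex_of_real (1 / norm x) *s x"
      have "?v = (1 / norm x) *\<^sub>R x" by (rule scaleR_vec_complex[symmetric])
      then have "norm ?v = 1" using x(1) by simp
      moreover have "cinner (g i) ?v = 0" if "i \<in> I \<union> J" for i
        using x(2)[OF that] by (simp add: cinner_scale_right)
      ultimately have "orthonormal_on (insert a (I \<union> J)) (g(a := ?v))"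
        using g(1) \<open>a \<notin> I \<union> J\<close> by (intro orthonormal_on_insert) auto
      moreover have "\<forall>i\<in>I. (g(a := ?v)) i = f i" using g(2) False by simp
      ultimately show ?thesis by (metis Un_insert_right)
    qed
  qed
  from this[of UNIV] show ?thesis using that by auto
qed

lemma unitary_groupD:
  assumes "U \<in> unitary_group"
  shows "conj_transpose U ** U = mat 1" "U ** conj_transpose U = mat 1"
    "conj_transpose U ** (U ** X) = X" "U ** (conj_transpose U ** X) = X"
  using assms by (auto simp: unitary_group_def matrix_mul_assoc)

lemma unitary_group_of_columns:
  assumes "orthonormal_on UNIV g"
  obtains U :: "complex^'n^'n" where "U \<in> unitary_group" "\<And>i. column i U = g i"
proof -
  define U :: "complex^'n^'n" where "U = (\<chi> k i. g i $ k)"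
  have c: "column i U = g i" for i by (simp add: U_def column_def vec_eq_iff)
  have "conj_transpose U ** U = mat 1"
    using assms by (simp add: vec_eq_iff conj_transpose_mult_nth c orthonormal_on_def mat_def)
  then have "U \<in> unitary_group"
    using matrix_left_right_inverse by (auto simp: unitary_group_def)
  then show ?thesis using that c by blast
qed

section \<open>The spectral theorem for Hermitian matrices and the rank of a diagonalized
  matrix\<close>

definition diag_matrix :: "('n \<Rightarrow> complex) \<Rightarrow> complex^'n^'n" where
  "diag_matrix d = (\<chi> i j. if i = j then d i else 0)"

lemma column_mult_diag_matrix: "column i (A ** diag_matrix d) = d i *s column i A"
  by (simp add: diag_matrix_def column_def matrix_matrix_mult_def vec_eq_iff mult.commute
      if_distrib cong: if_cong)

text \<open>The orthogonal complement of the eigenvectors found so far is invariant because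
  \<open>H\<close> is self-adjoint, and nonzero because \<open>a\<close> is vacant, so it contains
  another unit eigenvector.\<close>

lemma hermitian_eigenvector_family:
  fixes H :: "complex^'n^'n" and I :: "'n set"
  assumes H: "hermitian H" and fin: "finite I"
  shows "\<exists>f d. orthonormal_on I f \<and> (\<forall>i\<in>I. H *v f i = complex_of_real (d i) *s f i)"
  using fin
proof induction
  case empty
  then show ?case by (simp add: orthonormal_on_def)
next
  case (insert a I)
  then obtain f d where f: "orthonormal_on I f"
    and d: "\<And>i. i \<in> I \<Longrightarrow> H *v f i = complex_of_real (d i) *s f i" by blast
  note sc = scaleR_vec_complex
  let ?W = "{x. \<forall>i\<in>I. cinner (f i) x = 0}"
  have Hc: "cinner (H *v x) y = cinner x (H *v y)" for x y
    using H cinner_matrix_vector[of x H y] by (simp add: hermitian_def)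
  obtain w where w0: "w \<noteq> 0" and "\<And>i. i \<in> I \<Longrightarrow> cinner (f i) w = 0"
    using exists_nonzero_cinner_orthogonal[OF insert.hyps(2), of f] by metis
  then have wW: "w \<in> ?W" by simp
  have lin: "linear ((*v) H)"
    by (rule linearI) (simp_all add: sc vec.linear_scale[OF matrix_vector_mul_linear_gen]
        matrix_vector_right_distrib)
  \<comment> \<open>On C^n as a real Euclidean space \<open>H\<close> is self-adjoint too; the
    eigenvalue found there is a real scalar.\<close>
  have sym: "inner (H *v x) y = inner x (H *v y)" for x y
    using arg_cong[OF Hc[of x y], of Re] by (simp only: Re_cinner)
  have sub: "subspace ?W"
    by (simp add: subspace_def sc cinner_add_right cinner_scale_right)
  have inv: "H *v x \<in> ?W" if "x \<in> ?W" for x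
    using that by (simp add: Hc[symmetric] d cinner_scale_left)
  obtain v c where v: "v \<in> ?W" "norm v = 1" "H *v v = c *\<^sub>R v"
    by (rule selfadjoint_invariant_subspace_eigenvector[OF lin sym sub inv wW w0])
  have "orthonormal_on (insert a I) (f(a := v))"
    using f v insert.hyps by (intro orthonormal_on_insert) auto
  moreover have "\<forall>i\<in>insert a I. H *v (f(a := v)) i = complex_of_real ((d(a := c)) i) *s (f(a := v)) i"
    using d v(3) insert.hyps(2) by (auto simp: sc)
  ultimately show ?case by blast
qed

lemma hermitian_spectral:
  fixes H :: "complex^'n^'n"
  assumes "hermitian H"
  obtains U d where "U \<in> unitary_group"
    "H = U ** diag_matrix (\<lambda>i. complex_of_real (d i)) ** conj_transpose U"
    "\<And>i. H *v column i U = complex_of_real (d i) *s column i U"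
proof -
  obtain f :: "'n \<Rightarrow> complex^'n" and d where f: "orthonormal_on UNIV f"
    and d: "\<And>i. H *v f i = complex_of_real (d i) *s f i"
    using hermitian_eigenvector_family[OF assms, of UNIV] by auto
  obtain U where U: "U \<in> unitary_group" "\<And>i. column i U = f i"
    using unitary_group_of_columns[OF f] by blast
  have "column i (H ** U) = column i (U ** diag_matrix (\<lambda>i. complex_of_real (d i)))" for i
    unfolding column_mult_diag_matrix by (simp add: column_matrix_mult U d)
  then have "H ** U = U ** diag_matrix (\<lambda>i. complex_of_real (d i))"
    by (simp add: column_def vec_eq_iff)
  moreover have "H = H ** U ** conj_transpose U"
    by (simp add: matrix_mul_assoc[symmetric] unitary_groupD[OF U(1)])
  ultimately have "H = U ** diag_matrix (\<lambda>i. complex_of_real (d i)) ** conj_transpose U" by simp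
  then show ?thesis using that[OF U(1), of d] U(2) d by simp
qed

lemma nonneg_hermitian_spectral:
  fixes H :: "complex^'n^'n"
  assumes "nonneg_hermitian H"
  obtains U d where "U \<in> unitary_group"
    "H = U ** diag_matrix (\<lambda>i. complex_of_real (d i)) ** conj_transpose U" "\<And>i. d i \<ge> 0"
proof -
  have "hermitian H" using assms by (simp add: nonneg_hermitian_def)
  from hermitian_spectral[OF this] obtain U d where U: "U \<in> unitary_group"
    "H = U ** diag_matrix (\<lambda>i. complex_of_real (d i)) ** conj_transpose U"
    "\<And>i. H *v column i U = complex_of_real (d i) *s column i U" by blast
  have "d i \<ge> 0" for i
  proof -
    have "cinner (column i U) (column i U) = 1"
      using U(1) conj_transpose_mult_nth[of U U i i] by (simp add: unitary_group_def mat_def)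
    then have "column i U \<noteq> 0" by auto
    then have "complex_of_real (d i) \<in> \<real>\<^sub>\<ge>\<^sub>0"
      using assms U(3)[of i] unfolding nonneg_hermitian_def eigenvalue_def by blast
    then show ?thesis by simp
  qed
  then show ?thesis using that U by blast
qed

text \<open>An eigenvalue with eigenvector \<open>v\<close> is the quotient of the squared norms of
  \<open>A *v v\<close> and \<open>v\<close>.\<close>

lemma nonneg_hermitian_gram: "nonneg_hermitian (conj_transpose A ** (A :: complex^'n^'n))"
  unfolding nonneg_hermitian_def
proof (intro conjI allI impI)
  show "hermitian (conj_transpose A ** A)" by (simp add: hermitian_def conj_transpose_mult)
  fix c assume "eigenvalue (conj_transpose A ** A) c"
  then obtain v where v: "v \<noteq> 0" "(conj_transpose A ** A) *v v = c *s v"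
    by (auto simp: eigenvalue_def)
  have "c * cinner v v = cinner v (conj_transpose A *v (A *v v))"
    using v(2) by (simp add: cinner_scale_right matrix_vector_mul_assoc)
  also have "\<dots> = cinner (A *v v) (A *v v)" by (simp add: cinner_matrix_vector)
  finally have "c = complex_of_real ((norm (A *v v))\<^sup>2 / (norm v)\<^sup>2)"
    using v(1) by (simp add: cinner_self field_simps)
  then show "c \<in> \<real>\<^sub>\<ge>\<^sub>0" by (metis divide_nonneg_nonneg nonneg_Reals_of_real_iff zero_le_power2)
qed

text \<open>The row space of the product is spanned by the rows \<open>r k\<close> of
  \<open>conj_transpose U\<close> with \<open>d k \<noteq> 0\<close>; these are orthonormal, so
  their number is the dimension.\<close>

lemma rank_unitary_diag_matrix:
  fixes U :: "complex^'n^'n"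
  assumes "U \<in> unitary_group"
  shows "rank (U ** diag_matrix d ** conj_transpose U) = card {i. d i \<noteq> 0}"
proof -
  let ?H = "U ** diag_matrix d ** conj_transpose U" and ?P = "{i. d i \<noteq> 0}"
  define r where "r k = row k (conj_transpose U)" for k
  have rn: "r k $ j = cnj (U $ j $ k)" for k j by (simp add: r_def row_def conj_transpose_def)
  have UU: "conj_transpose U ** U = mat 1" using assms by (simp add: unitary_group_def)
  have "cinner (r i) (r j) = (conj_transpose U ** U) $ j $ i" for i j
    by (simp add: cinner_def rn matrix_matrix_mult_def conj_transpose_def mult.commute)
  then have on: "orthonormal_on ?P r" by (auto simp: orthonormal_on_def UU mat_def)
  have row: "row i ?H = (\<Sum>k\<in>UNIV. (U $ i $ k * d k) *s r k)" for i
    by (simp add: row_def vec_eq_iff rn matrix_matrix_mult_def diag_matrix_def conj_transpose_def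
        if_distrib cong: if_cong)
  have rowsub: "row i ?H \<in> vec.span (r ` ?P)" for i
    unfolding row
  proof (rule vec.span_sum)
    fix k
    show "(U $ i $ k * d k) *s r k \<in> vec.span (r ` ?P)"
      by (cases "d k = 0") (auto intro: vec.span_scale vec.span_base vec.span_zero)
  qed
  have rsub: "r k \<in> vec.span (rows ?H)" if "k \<in> ?P" for k
  proof -
    \<comment> \<open>Cancelling \<open>U\<close> on the left exhibits \<open>d k *s r k\<close> as
      a combination of the rows of \<open>?H\<close>; then one divides by
      \<open>d k\<close>.\<close>
    have e: "conj_transpose U ** ?H = diag_matrix d ** conj_transpose U"
      by (simp add: matrix_mul_assoc UU)
    have "d k *s r k = (\<Sum>i\<in>UNIV. r k $ i *s row i ?H)"
    proof (rule vec_eq_iff[THEN iffD2], rule)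
      fix j
      have "(d k *s r k) $ j = (diag_matrix d ** conj_transpose U) $ k $ j"
        by (simp add: rn matrix_matrix_mult_def diag_matrix_def conj_transpose_def
            if_distrib if_distribR cong: if_cong)
      also have "\<dots> = (\<Sum>i\<in>UNIV. r k $ i *s row i ?H) $ j"
        unfolding e[symmetric] matrix_matrix_mult_def[of "conj_transpose U" ?H]
        by (simp add: rn row_def conj_transpose_def)
      finally show "(d k *s r k) $ j = (\<Sum>i\<in>UNIV. r k $ i *s row i ?H) $ j" .
    qed
    also have "\<dots> \<in> vec.span (rows ?H)"
      by (intro vec.span_sum vec.span_scale vec.span_base) (auto simp: rows_def)
    finally have "(1 / d k) *s (d k *s r k) \<in> vec.span (rows ?H)" by (rule vec.span_scale)
    then show ?thesis using that by simp
  qed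
  have "vec.span (r ` ?P) = vec.span (rows ?H)"
    by (rule vec.span_eq[THEN iffD2]) (use rowsub rsub in \<open>auto simp: rows_def\<close>)
  then have "vec.dim (rows ?H) = card (r ` ?P)"
    by (rule vec.dim_eq_card) (rule orthonormal_on_imp_independent[OF on], simp)
  then show ?thesis
    by (simp add: row_rank_def_gen card_image orthonormal_on_imp_inj_on[OF on])
qed

section \<open>Pairs of matrices with equal diagonal Gram matrices\<close>

text \<open>For \<open>\<sigma>\<close> injective on the support of \<open>d\<close>, this is a
  partial permutation matrix times the square root of the diagonal matrix. Multiplying
  \<open>W\<close> by it on the right selects and scales columns of \<open>W\<close>. Values of
  \<open>\<sigma>\<close> off the support have no effect.\<close>

definition scaled_selection :: "('n \<Rightarrow> 'n) \<Rightarrow> ('n \<Rightarrow> real) \<Rightarrow> complex^'n^'n" where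
  "scaled_selection \<sigma> d = (\<chi> k i. if d i \<noteq> 0 \<and> k = \<sigma> i then complex_of_real (sqrt (d i)) else 0)"

lemma column_mult_scaled_selection:
  "column i (W ** scaled_selection \<sigma> d) =
     (if d i = 0 then 0 else complex_of_real (sqrt (d i)) *s column (\<sigma> i) W)"
  by (simp add: scaled_selection_def column_def matrix_matrix_mult_def vec_eq_iff mult.commute
      if_distrib cong: if_cong)

lemma gram_scaled_selection:
  "(conj_transpose (scaled_selection \<sigma> d) ** scaled_selection \<tau> d) $ i $ j =
     (if d i \<noteq> 0 \<and> d j \<noteq> 0 \<and> \<sigma> i = \<tau> j
      then complex_of_real (sqrt (d i)) * complex_of_real (sqrt (d j)) else 0)"
  (is "_ = ?c")
proof -
  have "(conj_transpose (scaled_selection \<sigma> d) ** scaled_selection \<tau> d) $ i $ j =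
      (\<Sum>k\<in>UNIV. if k = \<sigma> i then ?c else 0)"
    unfolding conj_transpose_mult_nth cinner_def
    by (rule sum.cong[OF refl]) (auto simp: column_def scaled_selection_def)
  then show ?thesis by simp
qed

lemma gram_scaled_selection_eq_diag:
  assumes "inj_on \<sigma> {i. d i \<noteq> 0}" "\<And>i. d i \<ge> 0"
  shows "conj_transpose (scaled_selection \<sigma> d) ** scaled_selection \<sigma> d =
    diag_matrix (\<lambda>i. complex_of_real (d i))"
proof -
  have sq: "complex_of_real (sqrt (d i)) * complex_of_real (sqrt (d i)) = complex_of_real (d i)" for i
    using assms(2)[of i] by (metis of_real_mult real_sqrt_mult_self abs_of_nonneg)
  have sel: "d i \<noteq> 0 \<and> d j \<noteq> 0 \<and> \<sigma> i = \<sigma> j \<longleftrightarrow> d i \<noteq> 0 \<and> i = j" for i j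
    using assms(1) by (auto dest: inj_onD)
  show ?thesis
    unfolding vec_eq_iff gram_scaled_selection sel diag_matrix_def vec_lambda_beta
    using sq by (metis of_real_0)
qed

lemma gram_scaled_selection_eq_0:
  assumes "\<And>i j. d i \<noteq> 0 \<Longrightarrow> d j \<noteq> 0 \<Longrightarrow> \<sigma> i \<noteq> \<tau> j"
  shows "conj_transpose (scaled_selection \<sigma> d) ** scaled_selection \<tau> d = 0"
  using assms by (auto simp: vec_eq_iff gram_scaled_selection)

definition normalized_column :: "('n \<Rightarrow> real) \<Rightarrow> complex^'n^'n \<Rightarrow> 'n \<Rightarrow> complex^'n" where
  "normalized_column d M i = complex_of_real (1 / sqrt (d i)) *s column i M"

text \<open>The diagonal Gram matrices give orthogonality within each family and the squared norms
  \<open>d i\<close>; \<open>conj_transpose N ** M = 0\<close> gives it across the families. The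
  disjoint sum counts every nonzero \<open>d i\<close> twice, which is the source of the bound by
  half the dimension.\<close>

lemma orthonormal_on_normalized_columns:
  fixes M N :: "complex^'n^'n"
  assumes d: "\<And>i. d i \<ge> 0"
    and MM: "conj_transpose M ** M = diag_matrix (\<lambda>i. complex_of_real (d i))"
    and NN: "conj_transpose N ** N = diag_matrix (\<lambda>i. complex_of_real (d i))"
    and NM: "conj_transpose N ** M = 0"
  shows "orthonormal_on ({i. d i \<noteq> 0} <+> {i. d i \<noteq> 0})
    (case_sum (normalized_column d M) (normalized_column d N))"
proof -
  have same: "cinner (normalized_column d K i) (normalized_column d K j) = (if i = j then 1 else 0)"
    if K: "conj_transpose K ** K = diag_matrix (\<lambda>i. complex_of_real (d i))" and i: "d i \<noteq> 0"
    for K :: "complex^'n^'n" and i j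
  proof -
    have "cinner (column i K) (column j K) = (if i = j then complex_of_real (d i) else 0)"
      using conj_transpose_mult_nth[of K K i j] by (simp add: K diag_matrix_def)
    moreover have "complex_of_real (sqrt (d i)) * complex_of_real (sqrt (d i)) = complex_of_real (d i)"
      using d[of i] by (metis of_real_mult real_sqrt_mult_self abs_of_nonneg)
    ultimately show ?thesis using i
      by (auto simp: normalized_column_def cinner_scale_left cinner_scale_right field_simps)
  qed
  have "cinner (column i N) (column j M) = 0" for i j
    using conj_transpose_mult_nth[of N M i j] by (simp add: NM)
  then have NM0: "cinner (normalized_column d N i) (normalized_column d M j) = 0" for i j
    by (simp add: normalized_column_def cinner_scale_left cinner_scale_right)
  then have MN0: "cinner (normalized_column d M j) (normalized_column d N i) = 0" for i j
    by (metis cinner_commute complex_cnj_zero)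
  show ?thesis
    using same[OF MM] same[OF NN] NM0 MN0 by (auto simp: orthonormal_on_def split: if_splits)
qed

text \<open>\<open>\<rho>\<close> assigns distinct columns of \<open>W\<close> to the normalized
  nonzero columns of \<open>M\<close> and \<open>N\<close>; the other columns complete them to an
  orthonormal basis. The right-hand factors depend only on \<open>\<rho>\<close> and
  \<open>d\<close>, so pairs sharing \<open>d\<close> differ by a unitary factor.\<close>

lemma gram_pair_normal_form:
  fixes M N :: "complex^'n^'n" and \<rho> :: "'n + 'n \<Rightarrow> 'n"
  assumes d: "\<And>i. d i \<ge> 0"
    and MM: "conj_transpose M ** M = diag_matrix (\<lambda>i. complex_of_real (d i))"
    and NN: "conj_transpose N ** N = diag_matrix (\<lambda>i. complex_of_real (d i))"
    and NM: "conj_transpose N ** M = 0"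
    and inj: "inj_on \<rho> ({i. d i \<noteq> 0} <+> {i. d i \<noteq> 0})"
  obtains W where "W \<in> unitary_group"
    "M = W ** scaled_selection (\<rho> \<circ> Inl) d" "N = W ** scaled_selection (\<rho> \<circ> Inr) d"
proof -
  let ?Q = "{i. d i \<noteq> 0} <+> {i. d i \<noteq> 0}"
  let ?g = "case_sum (normalized_column d M) (normalized_column d N)"
  \<comment> \<open>Reindexing along the inverse of \<open>\<rho>\<close> moves the family from the
    sum type to column positions, where it can be completed.\<close>
  have "orthonormal_on (\<rho> ` ?Q) (?g \<circ> inv_into ?Q \<rho>)"
    unfolding orthonormal_on_def
  proof (intro ballI)
    fix k l assume "k \<in> \<rho> ` ?Q" "l \<in> \<rho> ` ?Q"
    then obtain x y where xy: "x \<in> ?Q" "y \<in> ?Q" "k = \<rho> x" "l = \<rho> y" by blast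
    have "cinner (?g x) (?g y) = (if x = y then 1 else 0)"
      using orthonormal_on_normalized_columns[OF d MM NN NM] xy(1,2)
      unfolding orthonormal_on_def by blast
    moreover have "x = y \<longleftrightarrow> k = l" using inj xy by (metis inj_onD)
    ultimately show "cinner ((?g \<circ> inv_into ?Q \<rho>) k) ((?g \<circ> inv_into ?Q \<rho>) l) = (if k = l then 1 else 0)"
      using inj xy by simp
  qed
  then obtain G where G: "orthonormal_on UNIV G" "\<And>k. k \<in> \<rho> ` ?Q \<Longrightarrow> G k = (?g \<circ> inv_into ?Q \<rho>) k"
    using orthonormal_on_extend by blast
  obtain W where W: "W \<in> unitary_group" "\<And>i. column i W = G i"
    using unitary_group_of_columns[OF G(1)] by blast
  have \<rho>: "column (\<rho> x) W = ?g x" if "x \<in> ?Q" for x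
    using that G(2)[of "\<rho> x"] inj by (simp add: W(2))
  have \<rho>l: "column (\<rho> (Inl i)) W = normalized_column d M i"
    and \<rho>r: "column (\<rho> (Inr i)) W = normalized_column d N i" if "d i \<noteq> 0" for i
    using that \<rho>[of "Inl i"] \<rho>[of "Inr i"] by auto
  \<comment> \<open>For \<open>d i = 0\<close> the column has norm zero, matching the zero column of
    \<open>scaled_selection\<close>.\<close>
  have zero: "column i K = 0" if "conj_transpose K ** K = diag_matrix (\<lambda>i. complex_of_real (d i))" "d i = 0"
    for K :: "complex^'n^'n" and i
    using conj_transpose_mult_nth[of K K i i] that by (simp add: diag_matrix_def cinner_self)
  have nc: "complex_of_real (sqrt (d i)) *s normalized_column d K i = column i K" if "d i \<noteq> 0"
    for K :: "complex^'n^'n" and i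
    using that by (simp add: normalized_column_def)
  have "column i M = column i (W ** scaled_selection (\<rho> \<circ> Inl) d)" for i
    using zero[OF MM, of i] nc[of i M] \<rho>l[of i]
    by (cases "d i = 0") (simp_all add: column_mult_scaled_selection)
  then have 1: "M = W ** scaled_selection (\<rho> \<circ> Inl) d"
    by (simp add: column_def vec_eq_iff)
  have "column i N = column i (W ** scaled_selection (\<rho> \<circ> Inr) d)" for i
    using zero[OF NN, of i] nc[of i N] \<rho>r[of i]
    by (cases "d i = 0") (simp_all add: column_mult_scaled_selection)
  then have 2: "N = W ** scaled_selection (\<rho> \<circ> Inr) d"
    by (simp add: column_def vec_eq_iff)
  show ?thesis using that[OF W(1) 1 2] .
qed

section \<open>The zero fibre and its quotient\<close>

lemma mat_mult_nth: "(mat c ** X) $ i $ j = c * X $ i $ (j :: 'n::finite)"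
  for X :: "complex^'n^'n"
  by (simp add: mat_def matrix_matrix_mult_def mult_delta_left)

lemma mem_zero_fibre_iff:
  fixes A B :: "complex^'n^'n"
  shows "(A, B) \<in> zero_fibre \<longleftrightarrow> conj_transpose A ** A = B ** conj_transpose B \<and> B ** A = 0"
proof -
  have "mat (\<i> / 2) ** X = 0 \<longleftrightarrow> X = 0" for X :: "complex^'n^'n"
    by (auto simp: vec_eq_iff mat_mult_nth)
  then show ?thesis by (simp add: zero_fibre_def moment_map_def)
qed

text \<open>Both products have the form \<open>K ** conj_transpose K\<close>, so their difference is
  Hermitian, and an imaginary factor makes it skew-Hermitian.\<close>

lemma moment_map_skew_hermitian: "fst (moment_map p) \<in> skew_hermitian"
proof -
  obtain A B where p: "p = (A, B)" by fastforce
  define X where "X = conj_transpose A ** A - B ** conj_transpose B"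
  have "cnj ((K ** conj_transpose K) $ j $ i) = (K ** conj_transpose K) $ i $ j"
    for K :: "complex^'n^'n" and i j
    by (simp add: matrix_matrix_mult_def conj_transpose_def mult.commute)
  from this[of "conj_transpose A"] this[of B] have "cnj (X $ j $ i) = X $ i $ j" for i j
    by (simp add: X_def)
  then have "conj_transpose (mat (\<i> / 2) ** X) = - (mat (\<i> / 2) ** X)"
    unfolding vec_eq_iff by (simp add: conj_transpose_def mat_mult_nth)
  then show ?thesis by (simp add: p moment_map_def skew_hermitian_def X_def)
qed

lemma left_action_unitary:
  "U \<in> unitary_group \<Longrightarrow> left_action U (A, B) = (U ** A, B ** conj_transpose U)"
  by (simp add: left_action_def matrix_inv_unitary)

lemma moment_map_left_action:
  assumes "U \<in> unitary_group"
  shows "moment_map (left_action U p) = moment_map p"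
  using assms
  by (cases p) (simp add: left_action_unitary moment_map_def conj_transpose_mult
      unitary_groupD matrix_mul_assoc[symmetric])

text \<open>On the zero fibre this also equals \<open>B ** conj_transpose B\<close>, so it controls
  both components.\<close>

definition source_gram :: "(complex^'n^'n) \<times> (complex^'n^'n) \<Rightarrow> complex^'n^'n" where
  "source_gram p = conj_transpose (fst p) ** fst p"

lemma source_gram_left_action:
  assumes "U \<in> unitary_group"
  shows "source_gram (left_action U p) = source_gram p"
  using assms
  by (cases p) (simp add: left_action_unitary source_gram_def conj_transpose_mult
      unitary_groupD matrix_mul_assoc[symmetric])

section \<open>Normal forms for points of the zero fibre\<close>

lemma zero_fibre_diagonalized:
  fixes A B U :: "complex^'n^'n"
  assumes AB: "(A, B) \<in> zero_fibre" and U: "U \<in> unitary_group"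
    and H: "conj_transpose A ** A = U ** D ** conj_transpose U"
  shows "conj_transpose (A ** U) ** (A ** U) = D"
    "conj_transpose (conj_transpose B ** U) ** (conj_transpose B ** U) = D"
    "conj_transpose (conj_transpose B ** U) ** (A ** U) = 0"
proof -
  have A: "conj_transpose A ** (A ** X) = U ** (D ** (conj_transpose U ** X))" for X :: "complex^'n^'n"
    by (simp add: matrix_mul_assoc H)
  have "B ** conj_transpose B = U ** D ** conj_transpose U" "B ** A = 0"
    using AB H by (simp_all add: mem_zero_fibre_iff)
  then have B: "B ** (conj_transpose B ** X) = U ** (D ** (conj_transpose U ** X))"
    "B ** (A ** X) = 0" for X :: "complex^'n^'n"
    by (simp_all add: matrix_mul_assoc)
  show "conj_transpose (A ** U) ** (A ** U) = D"
    "conj_transpose (conj_transpose B ** U) ** (conj_transpose B ** U) = D"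
    "conj_transpose (conj_transpose B ** U) ** (A ** U) = 0"
    using unitary_groupD[OF U]
    by (simp_all add: conj_transpose_mult matrix_mul_assoc[symmetric] A B)
qed

text \<open>The pair acted on is determined by \<open>U\<close>, \<open>d\<close> and
  \<open>\<rho>\<close> alone, so points of the fibre with the same diagonalized Gram matrix lie in
  the orbit of a common point.\<close>

lemma zero_fibre_normal_form:
  fixes A B U :: "complex^'n^'n" and \<rho> :: "'n + 'n \<Rightarrow> 'n"
  assumes AB: "(A, B) \<in> zero_fibre" and U: "U \<in> unitary_group" and d: "\<And>i. d i \<ge> 0"
    and H: "conj_transpose A ** A = U ** diag_matrix (\<lambda>i. complex_of_real (d i)) ** conj_transpose U"
    and inj: "inj_on \<rho> ({i. d i \<noteq> 0} <+> {i. d i \<noteq> 0})"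
  shows "\<exists>W \<in> unitary_group. (A, B) = left_action W
    (scaled_selection (\<rho> \<circ> Inl) d ** conj_transpose U,
     U ** conj_transpose (scaled_selection (\<rho> \<circ> Inr) d))"
proof -
  obtain W where W: "W \<in> unitary_group" "A ** U = W ** scaled_selection (\<rho> \<circ> Inl) d"
    "conj_transpose B ** U = W ** scaled_selection (\<rho> \<circ> Inr) d"
    using gram_pair_normal_form[OF d zero_fibre_diagonalized[OF AB U H] inj] by blast
  have "A = W ** (scaled_selection (\<rho> \<circ> Inl) d ** conj_transpose U)"
    unfolding matrix_mul_assoc W(2)[symmetric]
    by (simp add: matrix_mul_assoc[symmetric] unitary_groupD[OF U])
  moreover have "conj_transpose U ** B = conj_transpose (scaled_selection (\<rho> \<circ> Inr) d) ** conj_transpose W"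
    using arg_cong[OF W(3), of conj_transpose] by (simp add: conj_transpose_mult)
  then have "B = U ** conj_transpose (scaled_selection (\<rho> \<circ> Inr) d) ** conj_transpose W"
    using unitary_groupD(4)[OF U, of B] by (simp add: matrix_mul_assoc)
  ultimately show ?thesis using W(1) by (auto simp: left_action_unitary)
qed

lemma zero_fibre_card_le:
  fixes A B U :: "complex^'n^'n"
  assumes AB: "(A, B) \<in> zero_fibre" and U: "U \<in> unitary_group" and d: "\<And>i. d i \<ge> 0"
    and H: "conj_transpose A ** A = U ** diag_matrix (\<lambda>i. complex_of_real (d i)) ** conj_transpose U"
  shows "card ({i. d i \<noteq> 0} <+> {i. d i \<noteq> 0}) \<le> CARD('n)"
  by (rule orthonormal_on_card_le[OF orthonormal_on_normalized_columns
        [OF d zero_fibre_diagonalized[OF AB U H]]]) simp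

text \<open>The witness is the normal form itself. Injectivity of \<open>\<rho>\<close> on each
  summand makes both Gram matrices equal to \<open>?D\<close>; disjointness of the images of the two
  summands makes the product \<open>B ** A\<close> vanish.\<close>

lemma exists_zero_fibre_source_gram:
  fixes U :: "complex^'n^'n" and \<rho> :: "'n + 'n \<Rightarrow> 'n"
  assumes U: "U \<in> unitary_group" and d: "\<And>i. d i \<ge> 0"
    and H: "H = U ** diag_matrix (\<lambda>i. complex_of_real (d i)) ** conj_transpose U"
    and inj: "inj_on \<rho> ({i. d i \<noteq> 0} <+> {i. d i \<noteq> 0})"
  shows "\<exists>p \<in> zero_fibre. source_gram p = H"
proof -
  let ?S = "scaled_selection (\<rho> \<circ> Inl) d" and ?T = "scaled_selection (\<rho> \<circ> Inr) d"
  let ?D = "diag_matrix (\<lambda>i. complex_of_real (d i))"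
  have inj_on: "d i \<noteq> 0 \<Longrightarrow> d j \<noteq> 0 \<Longrightarrow> \<rho> (Inl i) = \<rho> (Inl j) \<Longrightarrow> i = j"
    "d i \<noteq> 0 \<Longrightarrow> d j \<noteq> 0 \<Longrightarrow> \<rho> (Inr i) = \<rho> (Inr j) \<Longrightarrow> i = j"
    "d i \<noteq> 0 \<Longrightarrow> d j \<noteq> 0 \<Longrightarrow> \<rho> (Inl i) \<noteq> \<rho> (Inr j)" for i j
    using inj_onD[OF inj, of "Inl i" "Inl j"] inj_onD[OF inj, of "Inr i" "Inr j"]
      inj_onD[OF inj, of "Inl i" "Inr j"] by auto
  have S: "conj_transpose ?S ** ?S = ?D" and T: "conj_transpose ?T ** ?T = ?D"
    using inj_on d by (auto intro!: gram_scaled_selection_eq_diag simp: inj_on_def)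
  have TS: "conj_transpose ?T ** ?S = 0"
    using inj_on(3) by (intro gram_scaled_selection_eq_0) (metis comp_apply)
  have S': "conj_transpose ?S ** (?S ** X) = ?D ** X" "conj_transpose ?T ** (?T ** X) = ?D ** X"
    "conj_transpose ?T ** (?S ** X) = 0" for X :: "complex^'n^'n"
    by (simp_all add: matrix_mul_assoc S T TS)
  have "(?S ** conj_transpose U, U ** conj_transpose ?T) \<in> zero_fibre"
    by (simp add: mem_zero_fibre_iff conj_transpose_mult matrix_mul_assoc[symmetric] S')
  moreover have "source_gram (?S ** conj_transpose U, U ** conj_transpose ?T) = H"
    by (simp add: source_gram_def H conj_transpose_mult matrix_mul_assoc[symmetric] S')
  ultimately show ?thesis by blast
qed

section \<open>Image and fibres of the Gram map\<close>

abbreviation (input) half_rank_nonneg :: "(complex^'n^'n) set" where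
  "half_rank_nonneg \<equiv> {H. nonneg_hermitian H \<and> real (rank H) \<le> real CARD('n) / 2}"

lemma source_gram_image:
  "source_gram ` zero_fibre = (half_rank_nonneg :: (complex^'n^'n) set)"
proof (intro equalityI subsetI)
  fix H :: "complex^'n^'n" assume "H \<in> source_gram ` zero_fibre"
  then obtain A B where AB: "(A, B) \<in> zero_fibre" and H: "H = conj_transpose A ** A"
    by (auto simp: source_gram_def)
  have nn: "nonneg_hermitian H" unfolding H by (rule nonneg_hermitian_gram)
  then obtain U d where U: "U \<in> unitary_group" "\<And>i. d i \<ge> 0"
    and HU: "H = U ** diag_matrix (\<lambda>i. complex_of_real (d i)) ** conj_transpose U"
    using nonneg_hermitian_spectral by metis
  have "rank H = card {i. d i \<noteq> 0}"
    using rank_unitary_diag_matrix[OF U(1), of "\<lambda>i. complex_of_real (d i)"] by (simp add: HU)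
  then show "H \<in> half_rank_nonneg"
    using zero_fibre_card_le[OF AB U HU[unfolded H]] nn by (simp add: card_Plus)
next
  fix H :: "complex^'n^'n" assume "H \<in> half_rank_nonneg"
  then have nn: "nonneg_hermitian H" and rk: "real (rank H) \<le> real CARD('n) / 2" by auto
  obtain U d where U: "U \<in> unitary_group" "\<And>i. d i \<ge> 0"
    and HU: "H = U ** diag_matrix (\<lambda>i. complex_of_real (d i)) ** conj_transpose U"
    using nonneg_hermitian_spectral[OF nn] by metis
  have "rank H = card {i. d i \<noteq> 0}"
    using rank_unitary_diag_matrix[OF U(1), of "\<lambda>i. complex_of_real (d i)"] by (simp add: HU)
  \<comment> \<open>The rank bound says exactly that two copies of the support of \<open>d\<close>
    fit into the n column positions; this supplies \<open>\<rho>\<close>.\<close>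
  with rk have "card ({i. d i \<noteq> 0} <+> {i. d i \<noteq> 0}) \<le> CARD('n)" by (simp add: card_Plus)
  then obtain \<rho> :: "'n + 'n \<Rightarrow> 'n" where "inj_on \<rho> ({i. d i \<noteq> 0} <+> {i. d i \<noteq> 0})"
    using card_le_inj[of "{i. d i \<noteq> 0} <+> {i. d i \<noteq> 0}" "UNIV :: 'n set"] by auto
  from exists_zero_fibre_source_gram[OF U HU this] show "H \<in> source_gram ` zero_fibre" by blast
qed

lemma source_gram_eq_imp_orbit_rel:
  fixes p q :: "(complex^'n^'n) \<times> (complex^'n^'n)"
  assumes p: "p \<in> zero_fibre" and q: "q \<in> zero_fibre" and eq: "source_gram p = source_gram q"
  shows "(p, q) \<in> orbit_rel"
proof -
  obtain A B A' B' where pq: "p = (A, B)" "q = (A', B')" by (metis surj_pair)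
  have "nonneg_hermitian (conj_transpose A ** A)" by (rule nonneg_hermitian_gram)
  then obtain U d where U: "U \<in> unitary_group" "\<And>i. d i \<ge> 0"
    and HU: "conj_transpose A ** A = U ** diag_matrix (\<lambda>i. complex_of_real (d i)) ** conj_transpose U"
    using nonneg_hermitian_spectral by metis
  \<comment> \<open>One diagonalization serves both points; with the same \<open>U\<close>,
    \<open>d\<close> and \<open>\<rho>\<close> they get the same normal form, which is the
    \<open>r\<close> below.\<close>
  have HU': "conj_transpose A' ** A' = U ** diag_matrix (\<lambda>i. complex_of_real (d i)) ** conj_transpose U"
    using eq HU by (simp add: source_gram_def pq)
  have "card ({i. d i \<noteq> 0} <+> {i. d i \<noteq> 0}) \<le> CARD('n)"
    using zero_fibre_card_le[OF p[unfolded pq] U HU] .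
  then obtain \<rho> :: "'n + 'n \<Rightarrow> 'n" where inj: "inj_on \<rho> ({i. d i \<noteq> 0} <+> {i. d i \<noteq> 0})"
    using card_le_inj[of "{i. d i \<noteq> 0} <+> {i. d i \<noteq> 0}" "UNIV :: 'n set"] by auto
  obtain r where "(r, p) \<in> orbit_rel" "(r, q) \<in> orbit_rel"
    using zero_fibre_normal_form[OF p[unfolded pq] U HU inj]
      zero_fibre_normal_form[OF q[unfolded pq] U HU' inj]
    unfolding pq orbit_rel_def by blast
  then show ?thesis
    using equiv_orbit_rel by (meson equivE symE transE)
qed

section \<open>Continuity and properness of the Gram map\<close>

lemma continuous_on_conj_transpose [continuous_intros]:
  assumes "continuous_on S f"
  shows "continuous_on S (\<lambda>x. conj_transpose (f x))"
  unfolding conj_transpose_def using assms by (intro continuous_intros)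

lemma continuous_on_matrix_mult [continuous_intros]:
  fixes f :: "'a::topological_space \<Rightarrow> complex^'n^'m" and g :: "'a \<Rightarrow> complex^'k^'n"
  assumes "continuous_on S f" "continuous_on S g"
  shows "continuous_on S (\<lambda>x. f x ** g x)"
  unfolding matrix_matrix_mult_def using assms by (intro continuous_intros)

lemma continuous_on_source_gram: "continuous_on S source_gram"
  unfolding source_gram_def by (intro continuous_intros)

lemma closed_zero_fibre: "closed (zero_fibre :: ((complex^'n^'n) \<times> (complex^'n^'n)) set)"
proof -
  have "continuous_on UNIV (moment_map :: (complex^'n^'n) \<times> (complex^'n^'n) \<Rightarrow> _)"
    unfolding moment_map_def case_prod_unfold by (intro continuous_intros)
  then show ?thesis unfolding zero_fibre_def by (intro closed_vimage) auto
qed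

text \<open>The squared norm of \<open>A\<close> is the trace of its Gram matrix, a sum of n entries
  each bounded by the norm of that matrix.\<close>

lemma norm_power2_le_gram:
  fixes A :: "complex^'n^'n"
  shows "(norm A)\<^sup>2 \<le> real CARD('n) * norm (conj_transpose A ** A)"
proof -
  let ?H = "conj_transpose A ** A"
  have "(norm A)\<^sup>2 = (\<Sum>i\<in>UNIV. \<Sum>j\<in>UNIV. inner (A $ i $ j) (A $ i $ j))"
    by (simp add: power2_norm_eq_inner inner_vec_def)
  also have "\<dots> = (\<Sum>j\<in>UNIV. inner (column j A) (column j A))"
    by (subst sum.swap) (simp add: inner_vec_def column_def)
  also have "\<dots> = (\<Sum>j\<in>UNIV. Re (?H $ j $ j))"
    by (simp add: conj_transpose_mult_nth Re_cinner)
  also have "\<dots> \<le> (\<Sum>j\<in>(UNIV :: 'n set). norm ?H)"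
  proof (rule sum_mono)
    fix j
    have "Re (?H $ j $ j) \<le> norm (?H $ j $ j)" by (rule complex_Re_le_cmod)
    also have "\<dots> \<le> norm ?H"
      using Finite_Cartesian_Product.norm_nth_le[of "?H $ j" j]
        Finite_Cartesian_Product.norm_nth_le[of ?H j] by linarith
    finally show "Re (?H $ j $ j) \<le> norm ?H" .
  qed
  finally show ?thesis by simp
qed

lemma norm_conj_transpose: "norm (conj_transpose A) = norm (A :: complex^'n^'m)"
proof -
  have "(norm (conj_transpose A))\<^sup>2 = (norm A)\<^sup>2"
    unfolding power2_norm_eq_inner inner_vec_def
    by (subst sum.swap) (simp add: conj_transpose_def inner_complex_def)
  then show ?thesis by simp
qed

lemma compact_zero_fibre_vimage:
  fixes K :: "(complex^'n^'n) set"
  assumes "compact K"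
  shows "compact (zero_fibre \<inter> source_gram -` K)"
proof -
  have "closed (zero_fibre \<inter> source_gram -` K)"
    using assms by (intro closed_Int closed_zero_fibre closed_vimage continuous_on_source_gram
        compact_imp_closed)
  moreover have "bounded (zero_fibre \<inter> source_gram -` K)"
  proof -
    obtain b where b: "\<And>H. H \<in> K \<Longrightarrow> norm H \<le> b"
      using assms by (metis bounded_normE compact_imp_bounded)
    let ?c = "sqrt (real CARD('n) * b)"
    have le: "norm A \<le> ?c" if "conj_transpose A ** A \<in> K" for A :: "complex^'n^'n"
    proof -
      have "(norm A)\<^sup>2 \<le> real CARD('n) * b"
        using norm_power2_le_gram[of A] b[OF that] by (meson mult_left_mono of_nat_0_le_iff order_trans)
      then show ?thesis by (rule real_le_rsqrt)
    qed
    have "norm p \<le> ?c + ?c" if "p \<in> zero_fibre \<inter> source_gram -` K" for p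
    proof -
      obtain A B where p: "p = (A, B)" by fastforce
      have "norm A \<le> ?c" using that by (intro le) (simp add: p source_gram_def)
      \<comment> \<open>On the fibre the Gram matrix of \<open>conj_transpose B\<close> is again
        \<open>conj_transpose A ** A\<close>, so the same bound applies.\<close>
      moreover have "norm (conj_transpose B) \<le> ?c"
        using that by (intro le) (auto simp: p source_gram_def mem_zero_fibre_iff)
      ultimately show ?thesis
        using norm_Pair_le[of A B] by (simp add: p norm_conj_transpose)
    qed
    then show ?thesis by (rule boundedI)
  qed
  ultimately show ?thesis by (simp add: compact_eq_bounded_closed)
qed

lemma quotient_map_source_gram:
  "quotient_map (top_of_set zero_fibre) (top_of_set half_rank_nonneg)
    (source_gram :: _ \<Rightarrow> complex^'n^'n)"
proof (rule continuous_closed_imp_quotient_map)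
  show "continuous_map (top_of_set zero_fibre) (top_of_set half_rank_nonneg)
      (source_gram :: _ \<Rightarrow> complex^'n^'n)"
    using source_gram_image continuous_on_source_gram by fastforce
  \<comment> \<open>Compact preimages of compact sets make the map closed.\<close>
  show "closed_map (top_of_set zero_fibre) (top_of_set half_rank_nonneg)
      (source_gram :: _ \<Rightarrow> complex^'n^'n)"
    unfolding closed_map_def
    by (intro allI impI, erule proper_map) (simp_all add: compact_zero_fibre_vimage source_gram_image)
qed (simp add: source_gram_image)

section \<open>The homeomorphism induced on the orbit space\<close>

theorem theorem4p6:
  assumes "CARD('n::finite) > 1"
  shows "(moment_map :: (complex^'n^'n) \<times> (complex^'n^'n) \<Rightarrow> _) \<in> UNIV \<rightarrow> skew_hermitian \<times> UNIV
    \<and> (\<forall>U \<in> unitary_group. \<forall>p :: (complex^'n^'n) \<times> (complex^'n^'n).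
          moment_map (left_action U p) = moment_map p)
    \<and> (\<exists>h. homeomorphic_map
            (quotient_topology (top_of_set zero_fibre) orbit_rel)
            (top_of_set {H :: complex^'n^'n. nonneg_hermitian H \<and> real (rank H) \<le> real CARD('n) / 2})
            h
          \<and> (\<forall>(A :: complex^'n^'n, B) \<in> zero_fibre.
               h (orbit_rel `` {(A, B)}) = conj_transpose A ** A))"
proof (intro conjI)
  show "(moment_map :: (complex^'n^'n) \<times> (complex^'n^'n) \<Rightarrow> _) \<in> UNIV \<rightarrow> skew_hermitian \<times> UNIV"
    using moment_map_skew_hermitian by (auto simp: mem_Times_iff)
  show "\<forall>U \<in> unitary_group. \<forall>p :: (complex^'n^'n) \<times> (complex^'n^'n).
      moment_map (left_action U p) = moment_map p"
    by (simp add: moment_map_left_action)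
  let ?X = "top_of_set (zero_fibre :: ((complex^'n^'n) \<times> (complex^'n^'n)) set)"
  let ?Q = "quotient_topology ?X orbit_rel"
  let ?Y = "top_of_set (half_rank_nonneg :: (complex^'n^'n) set)"
  \<comment> \<open>Classes are orbits in all of X; since the moment map is invariant, the orbit of
    a point of the fibre stays in the fibre.\<close>
  let ?q = "\<lambda>p :: (complex^'n^'n) \<times> (complex^'n^'n). orbit_rel `` {p}"
  have q: "quotient_map ?X ?Q ?q" by (rule quotient_map_quotient_topology)
  have const: "source_gram x = source_gram y" if "?q x = ?q y" for x y
  proof -
    have "(x, y) \<in> orbit_rel" using eq_equiv_class[OF that equiv_orbit_rel] by simp
    then show ?thesis by (auto simp: orbit_rel_def source_gram_left_action)
  qed
  \<comment> \<open>The Gram map is constant on orbits, so it descends to a continuous map by the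
    universal property of the quotient.\<close>
  obtain h where h: "continuous_map ?Q ?Y h" "\<And>p. p \<in> zero_fibre \<Longrightarrow> h (?q p) = source_gram p"
  proof (rule quotient_map_lift_exists[OF q quotient_imp_continuous_map[OF quotient_map_source_gram]])
    show "source_gram x = source_gram y" if "?q x = ?q y" for x y by (rule const[OF that])
  qed auto
  \<comment> \<open>On the fibre the composite is the Gram map, hence a quotient map, and this
    passes to \<open>h\<close>. An injective quotient map is a homeomorphism, so the inverse is
    continuous as soon as \<open>h\<close> is injective.\<close>
  have "quotient_map ?X ?Y (h \<circ> ?q)"
    by (rule quotient_map_eq[OF quotient_map_source_gram]) (simp add: h(2))
  then have "quotient_map ?Q ?Y h"
    using quotient_map_from_composition[OF quotient_imp_continuous_map[OF q] h(1)] by blast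
  \<comment> \<open>Equal Gram matrices force a single orbit, by the common normal form.\<close>
  moreover have "inj_on h (topspace ?Q)"
  proof (rule inj_onI)
    fix C D assume CD: "C \<in> topspace ?Q" "D \<in> topspace ?Q" "h C = h D"
    then obtain x y where xy: "x \<in> zero_fibre" "y \<in> zero_fibre" "C = ?q x" "D = ?q y"
      by (auto simp: topspace_quotient_topology elim!: quotientE)
    then have "(x, y) \<in> orbit_rel" using CD(3) h(2) by (intro source_gram_eq_imp_orbit_rel) auto
    then show "C = D" using equiv_class_eq[OF equiv_orbit_rel] xy by blast
  qed
  ultimately have "homeomorphic_map ?Q ?Y h" by (simp add: homeomorphic_map_def)
  moreover have "\<forall>(A :: complex^'n^'n, B) \<in> zero_fibre. h (?q (A, B)) = conj_transpose A ** A"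
    using h(2) by (auto simp: source_gram_def)
  ultimately show "\<exists>h. homeomorphic_map ?Q ?Y h \<and>
      (\<forall>(A :: complex^'n^'n, B) \<in> zero_fibre. h (?q (A, B)) = conj_transpose A ** A)" by blast
qed

end
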